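(* Let $p,q\in\mathbb{R}$ and let $\nu\in\mathbb{R}$. Let $K_\nu$ be the modified Bessel function of the second kind. Then: (a) if $p\leq0$ and $q\geq1$, then $K_{\nu}$ is strictly $(p,q)$-convex on $(0,\infty)$ provided $\nu>1$ and $4(1-q)p^2\nu^2+4(q-2)p^2\nu+p^2(p^2+4)\leq0$; (b) if $p\leq0$ and $q\leq 0$, then $K_{\nu}$ is strictly $(p,q)$-concave on $(0,\infty)$; (c) if $p\geq0$ and $q<0$, then $K_{\nu}$ is strictly $(p,q)$-concave on $(0,\infty)$ provided $|\nu|\geq-p/q$; (d) if $p\geq0$ and $q\geq 1$, then $K_{\nu}$ is strictly $(p,q)$-convex on $(0,\infty)$; (e) if $p\geq1$ and $q\geq 0$, then $K_{\nu}$ is strictly $(p,q)$-convex on $(0,\infty)$.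
   Context: $K_\nu$ is the modified Bessel function of the second kind, given for $u>0$, $\nu\in\mathbb{R}$ by $K_{\nu}(u)=\int_0^{\infty}e^{-u\cosh t}\cosh(\nu t)\,dt$. For $r\in\mathbb{R}$, $\lambda\in[0,1]$ and $x,y>0$ define the weighted power mean $M_r^{(\lambda)}(x,y)=[\lambda x^r+(1-\lambda)y^r]^{1/r}$ if $r\neq0$ and $M_0^{(\lambda)}(x,y)=x^{\lambda}y^{1-\lambda}$. A function $f:(0,\infty)\to(0,\infty)$ is $(p,q)$-convex if $f(M_p^{(\lambda)}(u_1,u_2))\leq M_q^{(\lambda)}(f(u_1),f(u_2))$ for all $u_1,u_2>0$ and $\lambda\in[0,1]$, and $(p,q)$-concave if the reverse inequality holds; "strictly" means the inequality is strict whenever $u_1\neq u_2$ and $\lambda\in(0,1)$. *)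

theory Defs
  imports "HOL-Analysis.Analysis"
begin

text \<open>Modified Bessel function of the second kind, for u > 0:
  K_nu(u) = integral over (0,infinity) of exp(-u cosh t) cosh(nu t) dt
  (Lebesgue integral; the integrand is absolutely integrable for u > 0).\<close>
definition besselK :: "real \<Rightarrow> real \<Rightarrow> real" where
  "besselK \<nu> u = (LINT t:{0<..}|lborel. exp (- u * cosh t) * cosh (\<nu> * t))"

definition power_mean :: "real \<Rightarrow> real \<Rightarrow> real \<Rightarrow> real \<Rightarrow> real" where
  "power_mean r w x y =
     (if r = 0 then x powr w * y powr (1 - w)
      else (w * x powr r + (1 - w) * y powr r) powr (1 / r))"

definition strictly_pq_convex :: "real \<Rightarrow> real \<Rightarrow> (real \<Rightarrow> real) \<Rightarrow> bool" where
  "strictly_pq_convex p q f \<longleftrightarrow>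
     (\<forall>u1>0. \<forall>u2>0. \<forall>w\<in>{0..1}.
        f (power_mean p w u1 u2) \<le> power_mean q w (f u1) (f u2)) \<and>
     (\<forall>u1>0. \<forall>u2>0. \<forall>w\<in>{0<..<1}. u1 \<noteq> u2 \<longrightarrow>
        f (power_mean p w u1 u2) < power_mean q w (f u1) (f u2))"

definition strictly_pq_concave :: "real \<Rightarrow> real \<Rightarrow> (real \<Rightarrow> real) \<Rightarrow> bool" where
  "strictly_pq_concave p q f \<longleftrightarrow>
     (\<forall>u1>0. \<forall>u2>0. \<forall>w\<in>{0..1}.
        f (power_mean p w u1 u2) \<ge> power_mean q w (f u1) (f u2)) \<and>
     (\<forall>u1>0. \<forall>u2>0. \<forall>w\<in>{0<..<1}. u1 \<noteq> u2 \<longrightarrow>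
        f (power_mean p w u1 u2) > power_mean q w (f u1) (f u2))"

end

theory Submission
  imports Defs
begin

text \<open>For positive \<open>f\<close>, strict \<open>(p,q)\<close>-convexity follows once
  \<open>u\<^bsup>1-p\<^esup> f(u)\<^bsup>q-1\<^esup> f'(u)\<close> is strictly increasing. For \<open>f = K\<^sub>\<nu>\<close> put \<open>s = - u K\<^sub>\<nu>' / K\<^sub>\<nu> > 0\<close>; Bessel's
  equation shows that the derivative of this quantity has the sign of
  \<open>p s + (q - 1) s\<^sup>2 + u\<^sup>2 + \<nu>\<^sup>2\<close>. This sign is read off from three bounds: Turan's inequality
  gives \<open>s\<^sup>2 > u\<^sup>2 + \<nu>\<^sup>2\<close>, log-convexity of \<open>K\<^sub>\<nu>\<close> gives \<open>s\<^sup>2 < u\<^sup>2 + \<nu>\<^sup>2 + s\<close>, and for \<open>\<nu> > 1\<close> the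
  reversed Turan inequality gives \<open>s\<^sup>2 < \<nu>\<^sup>2 + u\<^sup>2 \<nu> / (\<nu> - 1)\<close>.\<close>

section \<open>Laplace-type integrals in the hyperbolic cosine\<close>

text \<open>The weight \<open>exp (- u * cosh t)\<close> decays doubly exponentially, so this class
  of integrands is integrable against it for every \<open>u > 0\<close>. The class is closed under
  sums and products. Continuity supplies measurability and the fundamental theorem of
  calculus.\<close>

definition exp_growth :: "(real \<Rightarrow> real) \<Rightarrow> bool" where
  "exp_growth g \<longleftrightarrow> continuous_on UNIV g \<and> (\<exists>C a. \<forall>t\<ge>0. \<bar>g t\<bar> \<le> C * exp (a * t))"

definition cosh_laplace :: "(real \<Rightarrow> real) \<Rightarrow> real \<Rightarrow> real" where
  "cosh_laplace g u = (LINT t:{0<..}|lborel. exp (- u * cosh t) * g t)"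

lemma exp_growthE:
  assumes "exp_growth g"
  obtains C a where "C \<ge> 0" "a \<ge> 0" "\<And>t. t \<ge> 0 \<Longrightarrow> \<bar>g t\<bar> \<le> C * exp (a * t)"
proof -
  obtain C a where Ca: "\<And>t. t \<ge> 0 \<Longrightarrow> \<bar>g t\<bar> \<le> C * exp (a * t)"
    using assms unfolding exp_growth_def by blast
  have C: "C \<ge> 0" using Ca[of 0] by simp
  show ?thesis
  proof (rule that[of C "\<bar>a\<bar>"])
    fix t :: real assume t: "t \<ge> 0"
    have "C * exp (a * t) \<le> C * exp (\<bar>a\<bar> * t)"
      using C t by (intro mult_left_mono) (auto intro: mult_right_mono)
    then show "\<bar>g t\<bar> \<le> C * exp (\<bar>a\<bar> * t)" using Ca[OF t] by linarith
  qed (use C in auto)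
qed

section \<open>Closure properties of the growth class\<close>

lemma exp_growth_const [intro, simp]: "exp_growth (\<lambda>t. c)"
  unfolding exp_growth_def by (intro conjI exI[of _ "\<bar>c\<bar>"] exI[of _ 0]) auto

lemma exp_growth_add [intro]:
  assumes "exp_growth g" "exp_growth h"
  shows "exp_growth (\<lambda>t. g t + h t)"
proof -
  obtain C a where 1: "C \<ge> 0" "a \<ge> 0" "\<And>t. t \<ge> 0 \<Longrightarrow> \<bar>g t\<bar> \<le> C * exp (a * t)"
    using assms exp_growthE by blast
  obtain D b where 2: "D \<ge> 0" "b \<ge> 0" "\<And>t. t \<ge> 0 \<Longrightarrow> \<bar>h t\<bar> \<le> D * exp (b * t)"
    using assms exp_growthE by blast
  have "\<bar>g t + h t\<bar> \<le> (C + D) * exp ((a + b) * t)" if t: "t \<ge> 0" for t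
  proof -
    have "C * exp (a * t) \<le> C * exp ((a + b) * t)" "D * exp (b * t) \<le> D * exp ((a + b) * t)"
      using 1 2 t by (auto intro!: mult_left_mono mult_right_mono)
    then show ?thesis using 1(3)[OF t] 2(3)[OF t] by (simp add: distrib_right)
  qed
  then show ?thesis using assms unfolding exp_growth_def by (auto intro!: continuous_intros)
qed

lemma exp_growth_mult [intro]:
  assumes "exp_growth g" "exp_growth h"
  shows "exp_growth (\<lambda>t. g t * h t)"
proof -
  obtain C a where 1: "C \<ge> 0" "a \<ge> 0" "\<And>t. t \<ge> 0 \<Longrightarrow> \<bar>g t\<bar> \<le> C * exp (a * t)"
    using assms exp_growthE by blast
  obtain D b where 2: "D \<ge> 0" "b \<ge> 0" "\<And>t. t \<ge> 0 \<Longrightarrow> \<bar>h t\<bar> \<le> D * exp (b * t)"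
    using assms exp_growthE by blast
  have "\<bar>g t * h t\<bar> \<le> (C * D) * exp ((a + b) * t)" if t: "t \<ge> 0" for t
  proof -
    have "\<bar>g t\<bar> * \<bar>h t\<bar> \<le> (C * exp (a * t)) * (D * exp (b * t))"
      using 1 2 t by (intro mult_mono) auto
    then show ?thesis by (simp add: abs_mult exp_add algebra_simps)
  qed
  then show ?thesis using assms unfolding exp_growth_def by (auto intro!: continuous_intros)
qed

lemma exp_growth_abs [intro]: "exp_growth g \<Longrightarrow> exp_growth (\<lambda>t. \<bar>g t\<bar>)"
  unfolding exp_growth_def by (auto intro!: continuous_intros)

lemma exp_growth_exp [intro]: "exp_growth (\<lambda>t. exp (c * t))"
  unfolding exp_growth_def
  by (intro conjI continuous_intros exI[of _ 1] exI[of _ c]) auto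

lemma exp_growth_cosh_mult [intro, simp]: "exp_growth (\<lambda>t. cosh (c * t))"
proof -
  have "(\<lambda>t. cosh (c * t)) = (\<lambda>t. 1/2 * (exp (c * t) + exp ((-c) * t)))"
    by (simp add: cosh_field_def)
  then show ?thesis
    by (metis (no_types) exp_growth_mult[OF exp_growth_const exp_growth_add[OF exp_growth_exp exp_growth_exp]])
qed

lemma exp_growth_sinh_mult [intro, simp]: "exp_growth (\<lambda>t. sinh (c * t))"
proof -
  have "(\<lambda>t. sinh (c * t)) = (\<lambda>t. 1/2 * exp (c * t) + (-1/2) * exp ((-c) * t))"
    by (simp add: sinh_field_def field_simps)
  then show ?thesis
    by (metis (no_types) exp_growth_add[OF exp_growth_mult[OF exp_growth_const exp_growth_exp]
          exp_growth_mult[OF exp_growth_const exp_growth_exp]])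
qed

lemma exp_growth_cosh [intro, simp]: "exp_growth cosh"
  using exp_growth_cosh_mult[of 1] by simp

lemma exp_growth_sinh [intro, simp]: "exp_growth sinh"
  using exp_growth_sinh_mult[of 1] by simp

text \<open>Since \<open>u * cosh t >= (u/2) * exp t\<close> outgrows every linear function, the
  weight beats \<open>exp (a * t)\<close> with a factor \<open>exp (- t)\<close> to spare.\<close>

lemma exp_cosh_growth_bound:
  assumes "exp_growth g" "u > 0"
  obtains C where "\<And>t. t \<ge> 0 \<Longrightarrow> \<bar>exp (- u * cosh t) * g t\<bar> \<le> C * exp (- t)"
proof -
  obtain C a where 1: "C \<ge> 0" "a \<ge> 0" "\<And>t. t \<ge> 0 \<Longrightarrow> \<bar>g t\<bar> \<le> C * exp (a * t)"
    using assms exp_growthE by blast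
  \<comment> \<open>The point where the convex function \<open>(u/2) * exp t\<close> has slope
    \<open>a + 1\<close>; its tangent line there is the linear lower bound.\<close>
  define s where "s = ln (2 * (a + 1) / u)"
  have s: "u / 2 * exp s = a + 1" using 1 assms by (simp add: s_def)
  have "\<bar>exp (- u * cosh t) * g t\<bar> \<le> C * exp ((a + 1) * (s - 1)) * exp (- t)" if t: "t \<ge> 0" for t
  proof -
    have "(a + 1) * (1 + (t - s)) \<le> (u / 2 * exp s) * exp (t - s)"
      unfolding s using 1 by (intro mult_left_mono exp_ge_add_one_self) auto
    also have "\<dots> = u / 2 * exp t" by (simp add: exp_diff)
    also have "\<dots> \<le> u * cosh t" using assms by (simp add: cosh_field_def)
    finally have le: "- u * cosh t + a * t \<le> (a + 1) * (s - 1) - t" by (simp add: algebra_simps)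
    have "\<bar>exp (- u * cosh t) * g t\<bar> \<le> exp (- u * cosh t) * (C * exp (a * t))"
      unfolding abs_mult using 1(3)[OF t] by (intro mult_mono) auto
    also have "\<dots> = C * exp (- u * cosh t + a * t)" unfolding exp_add by simp
    also have "\<dots> \<le> C * exp ((a + 1) * (s - 1) - t)" using le 1 by (intro mult_left_mono) auto
    finally show ?thesis by (simp add: exp_diff exp_minus divide_inverse mult.assoc)
  qed
  then show ?thesis by (rule that)
qed

lemma set_integrable_exp_minus_Ioi: "set_integrable lborel {0<..} (\<lambda>t::real. exp (- t))"
proof -
  have "set_integrable lebesgue {0..} (\<lambda>t::real. exp (- 1 * t))"
    by (rule nonnegative_absolutely_integrable_1[OF has_integral_integrable[OF has_integral_exp_minus_to_infinity]]) auto
  then have "set_integrable lebesgue {0<..} (\<lambda>t::real. exp (- t))"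
    by (auto intro: set_integrable_subset)
  then show ?thesis
    unfolding set_integrable_def by (simp add: integrable_completion)
qed

lemma cosh_laplace_integrable:
  assumes "exp_growth g" "u > 0"
  shows "set_integrable lborel {0<..} (\<lambda>t. exp (- u * cosh t) * g t)"
proof -
  obtain C where C: "\<And>t. t \<ge> 0 \<Longrightarrow> \<bar>exp (- u * cosh t) * g t\<bar> \<le> C * exp (- t)"
    using exp_cosh_growth_bound[OF assms] by blast
  show ?thesis
  proof (rule set_integrable_bound)
    show "set_integrable lborel {0<..} (\<lambda>t. C * exp (- t))"
      using set_integrable_exp_minus_Ioi by simp
    have "continuous_on {0<..} (\<lambda>t. exp (- u * cosh t) * g t)"
      using assms unfolding exp_growth_def by (auto intro!: continuous_intros continuous_on_subset[of UNIV g])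
    then show "set_borel_measurable lborel {0<..} (\<lambda>t. exp (- u * cosh t) * g t)"
      unfolding set_borel_measurable_def
      using borel_measurable_continuous_on_indicator[of "{0<..}" "\<lambda>t. exp (- u * cosh t) * g t"] by simp
    show "AE x in lborel. x \<in> {0<..} \<longrightarrow> norm (exp (- u * cosh x) * g x) \<le> norm (C * exp (- x))"
      using C by (intro AE_I2) (auto intro: order_trans[OF _ abs_ge_self])
  qed
qed

section \<open>Linearity and strict positivity of the transform\<close>

lemma cosh_laplace_add:
  assumes "exp_growth g" "exp_growth h" "u > 0"
  shows "cosh_laplace (\<lambda>t. g t + h t) u = cosh_laplace g u + cosh_laplace h u"
  using set_integral_add(2)[OF cosh_laplace_integrable cosh_laplace_integrable, of g u h u] assms
  by (simp add: cosh_laplace_def distrib_left)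

lemma cosh_laplace_cmult: "cosh_laplace (\<lambda>t. c * g t) u = c * cosh_laplace g u"
proof -
  have "(\<lambda>t. exp (- u * cosh t) * (c * g t)) = (\<lambda>t. c * (exp (- u * cosh t) * g t))"
    by (simp add: mult.left_commute)
  then show ?thesis unfolding cosh_laplace_def by (simp del: mult_minus_left)
qed

lemma cosh_laplace_lincomb:
  assumes "exp_growth f" "exp_growth g" "exp_growth h" "u > 0"
  shows "cosh_laplace (\<lambda>t. a * f t + b * g t) u = a * cosh_laplace f u + b * cosh_laplace g u"
    and "cosh_laplace (\<lambda>t. a * f t + b * g t + c * h t) u
      = a * cosh_laplace f u + b * cosh_laplace g u + c * cosh_laplace h u"
  using assms
  by (simp_all add: cosh_laplace_add cosh_laplace_cmult exp_growth_add
      exp_growth_mult[OF exp_growth_const])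

text \<open>A nonnegative integrand with zero integral vanishes almost everywhere, which a finite
  zero set rules out. Zeros have to be allowed because of the perfect square in
  \<open>besselK_log_convex\<close>.\<close>

lemma cosh_laplace_pos:
  assumes "exp_growth g" "u > 0" "\<And>t. t > 0 \<Longrightarrow> g t \<ge> 0" "finite {t. t > 0 \<and> g t = 0}"
  shows "cosh_laplace g u > 0"
proof -
  let ?f = "\<lambda>t. indicator {0<..} t *\<^sub>R (exp (- u * cosh t) * g t)"
  have int: "integrable lborel ?f"
    using cosh_laplace_integrable[OF assms(1,2)] by (simp add: set_integrable_def)
  have nn: "AE t in lborel. 0 \<le> ?f t"
    using assms(3) by (intro AE_I2) (auto simp: indicator_def)
  have "integral\<^sup>L lborel ?f \<noteq> 0"
  proof
    assume "integral\<^sup>L lborel ?f = 0"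
    then have "AE t in lborel. ?f t = 0"
      using integral_nonneg_eq_0_iff_AE[OF int nn] by simp
    moreover have "AE t in lborel. t \<notin> {t. t > 0 \<and> g t = 0}"
      using assms(4) by (intro AE_not_in finite_imp_null_set_lborel)
    ultimately have "AE t in lborel. t \<notin> {0<..<1::real}"
      by eventually_elim (auto simp: indicator_def split: if_splits)
    then have "emeasure lborel {0<..<1::real} = 0"
      by (subst (asm) AE_iff_measurable[of "{0<..<1}"]) auto
    then show False by simp
  qed
  moreover have "integral\<^sup>L lborel ?f \<ge> 0" using nn by (rule integral_nonneg_AE)
  ultimately show ?thesis by (simp add: cosh_laplace_def set_lebesgue_integral_def)
qed

text \<open>Integration by parts in \<open>t\<close>: the boundary term vanishes at 0 because
  \<open>g 0 = 0\<close>, and at infinity by the decay of the weight. Choices of \<open>g\<close>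
  yield the Bessel identities.\<close>

lemma cosh_laplace_FTC:
  assumes "exp_growth g" "exp_growth k" "u > 0" "g 0 = 0"
    and deriv: "\<And>t. ((\<lambda>t. exp (- u * cosh t) * g t) has_real_derivative exp (- u * cosh t) * k t) (at t)"
  shows "cosh_laplace k u = 0"
proof -
  let ?H = "\<lambda>t. exp (- u * cosh t) * g t"
  have "(LBINT t=0..\<infinity>. exp (- u * cosh t) * k t) = 0 - 0"
  proof (rule interval_integral_FTC_integrable[where F = ?H])
    show "((?H \<circ> real_of_ereal) \<longlongrightarrow> 0) (at_right 0)"
    proof -
      have "(?H \<longlongrightarrow> ?H 0) (at_right 0)"
        using DERIV_isCont[OF deriv[of 0]] by (auto simp: isCont_def intro: filterlim_mono at_le)
      then show ?thesis using \<open>g 0 = 0\<close> by (simp add: zero_ereal_def ereal_tendsto_simps)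
    qed
    obtain C where C: "\<And>t. t \<ge> 0 \<Longrightarrow> \<bar>?H t\<bar> \<le> C * exp (- t)"
      using exp_cosh_growth_bound[OF assms(1,3)] by blast
    have "((\<lambda>t. C * exp (- t)) \<longlongrightarrow> 0) at_top"
      by (rule tendsto_mult_right_zero, rule filterlim_compose[OF exp_at_bot filterlim_uminus_at_bot_at_top])
    then have "(?H \<longlongrightarrow> 0) at_top"
      by (rule Lim_null_comparison[rotated])
        (auto intro!: eventually_mono[OF eventually_ge_at_top[of 0]] C[unfolded mult_minus_left])
    then show "((?H \<circ> real_of_ereal) \<longlongrightarrow> 0) (at_left \<infinity>)"
      by (simp add: ereal_tendsto_simps)
    show "set_integrable lborel (einterval 0 \<infinity>) (\<lambda>t. exp (- u * cosh t) * k t)"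
      using cosh_laplace_integrable[OF assms(2,3)] by (simp add: zero_ereal_def)
    show "isCont (\<lambda>t. exp (- u * cosh t) * k t) x" for x
      using assms(2) by (auto simp: exp_growth_def continuous_on_eq_continuous_at intro!: continuous_intros)
    show "(?H has_vector_derivative exp (- u * cosh x) * k x) (at x)" for x
      using deriv[of x] by (simp add: has_real_derivative_iff_has_vector_derivative)
  qed simp
  then show ?thesis by (simp add: cosh_laplace_def interval_lebesgue_integral_0_infty)
qed

text \<open>Apply \<open>exp y - 1 <= y * exp y\<close> twice. Quadratic order is what matters: it
  makes the error of the difference quotient \<open>O(d)\<close>.\<close>

lemma exp_taylor_remainder: "\<bar>exp x - 1 - x\<bar> \<le> x\<^sup>2 * exp \<bar>x\<bar>" for x :: real
proof -
  have *: "exp y - 1 \<le> y * exp y" for y :: real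
  proof -
    have "(1 + - y) * exp y \<le> exp (- y) * exp y" by (intro mult_right_mono exp_ge_add_one_self) auto
    then show ?thesis by (simp add: exp_minus algebra_simps)
  qed
  have "\<bar>exp x - 1\<bar> \<le> \<bar>x\<bar> * exp \<bar>x\<bar>"
  proof (cases "x \<ge> 0")
    case True then show ?thesis using *[of x] by simp
  next
    case False
    have "\<bar>x\<bar> * 1 \<le> \<bar>x\<bar> * exp \<bar>x\<bar>" by (intro mult_left_mono) auto
    moreover have "\<bar>exp x - 1\<bar> \<le> \<bar>x\<bar>" using False exp_ge_add_one_self[of x] exp_le_one_iff[of x] by linarith
    ultimately show ?thesis by linarith
  qed
  then have "\<bar>x\<bar> * \<bar>exp x - 1\<bar> \<le> \<bar>x\<bar> * (\<bar>x\<bar> * exp \<bar>x\<bar>)" by (intro mult_left_mono) auto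
  then have "x * (exp x - 1) \<le> x\<^sup>2 * exp \<bar>x\<bar>"
    using abs_ge_self[of "x * (exp x - 1)"] by (simp add: abs_mult power2_eq_square mult.assoc)
  then show ?thesis
    using *[of x] exp_ge_add_one_self[of x] by (simp add: algebra_simps)
qed

text \<open>Differentiation under the integral sign with an explicit rate: the Taylor remainder of
  \<open>exp (- d * cosh t)\<close> is integrated directly.\<close>

lemma cosh_laplace_deriv:
  assumes g: "exp_growth g" and u: "u > 0"
  shows "(cosh_laplace g has_real_derivative - cosh_laplace (\<lambda>t. cosh t * g t) u) (at u)"
proof -
  \<comment> \<open>Passing from \<open>u\<close> to \<open>u / 2\<close> pays for the factor
    \<open>exp (\<bar>d\<bar> * cosh t)\<close> of the remainder, as
    \<open>\<bar>d\<bar> < u / 2\<close>.\<close>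
  define B where "B = cosh_laplace (\<lambda>t. cosh t * cosh t * \<bar>g t\<bar>) (u / 2)"
  have bound: "\<bar>(cosh_laplace g (u + d) - cosh_laplace g u) / d + cosh_laplace (\<lambda>t. cosh t * g t) u\<bar> \<le> \<bar>d\<bar> * B"
    if d: "d \<noteq> 0" "\<bar>d\<bar> < u / 2" for d
  proof -
    have ud: "u + d > 0" using d u by linarith
    \<comment> \<open>The integrand of \<open>d\<close> times the error of the difference
      quotient.\<close>
    let ?R = "\<lambda>t. (exp (- (u + d) * cosh t) * g t - exp (- u * cosh t) * g t) + d * (exp (- u * cosh t) * (cosh t * g t))"
    have i1: "set_integrable lborel {0<..} (\<lambda>t. exp (- (u + d) * cosh t) * g t)"
      by (rule cosh_laplace_integrable[OF g ud])
    have i2: "set_integrable lborel {0<..} (\<lambda>t. exp (- u * cosh t) * g t)"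
      by (rule cosh_laplace_integrable[OF g u])
    have i3: "set_integrable lborel {0<..} (\<lambda>t. d * (exp (- u * cosh t) * (cosh t * g t)))"
      using cosh_laplace_integrable[OF exp_growth_mult[OF exp_growth_cosh g] u] by simp
    have i4: "set_integrable lborel {0<..} (\<lambda>t. d\<^sup>2 * (exp (- (u / 2) * cosh t) * (cosh t * cosh t * \<bar>g t\<bar>)))"
      using cosh_laplace_integrable[OF exp_growth_mult[OF exp_growth_mult[OF exp_growth_cosh exp_growth_cosh] exp_growth_abs[OF g]], of "u / 2"] u
      by simp
    have iR: "set_integrable lborel {0<..} ?R"
      by (intro set_integral_add(1) set_integral_diff(1) i1 i2 i3)
    have "(LINT t:{0<..}|lborel. ?R t) = (cosh_laplace g (u + d) - cosh_laplace g u) + d * cosh_laplace (\<lambda>t. cosh t * g t) u"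
      unfolding cosh_laplace_def set_integral_add(2)[OF set_integral_diff(1)[OF i1 i2] i3]
        set_integral_diff(2)[OF i1 i2] set_integral_mult_right ..
    moreover have "\<bar>LINT t:{0<..}|lborel. ?R t\<bar> \<le> (LINT t:{0<..}|lborel. \<bar>?R t\<bar>)"
      using set_integral_norm_bound[OF iR] by simp
    moreover have "(LINT t:{0<..}|lborel. \<bar>?R t\<bar>) \<le>
        (LINT t:{0<..}|lborel. d\<^sup>2 * (exp (- (u / 2) * cosh t) * (cosh t * cosh t * \<bar>g t\<bar>)))"
    proof (rule set_integral_mono)
      show "set_integrable lborel {0<..} (\<lambda>t. \<bar>?R t\<bar>)" using iR by (rule set_integrable_abs)
      show "\<bar>?R t\<bar> \<le> d\<^sup>2 * (exp (- (u / 2) * cosh t) * (cosh t * cosh t * \<bar>g t\<bar>))" for t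
      proof -
        let ?x = "- d * cosh t"
        have "exp (- (u + d) * cosh t) = exp (- u * cosh t) * exp ?x"
          by (simp add: algebra_simps flip: exp_add)
        have "?R t = exp (- u * cosh t) * g t * (exp ?x - 1 - ?x)"
          unfolding \<open>exp (- (u + d) * cosh t) = exp (- u * cosh t) * exp ?x\<close> by (simp add: algebra_simps)
        then have "\<bar>?R t\<bar> = exp (- u * cosh t) * \<bar>g t\<bar> * \<bar>exp ?x - 1 - ?x\<bar>"
          by (simp only: abs_mult abs_exp_cancel)
        also have "\<dots> \<le> exp (- u * cosh t) * \<bar>g t\<bar> * (?x\<^sup>2 * exp \<bar>?x\<bar>)"
          by (intro mult_left_mono exp_taylor_remainder) auto
        also have "\<dots> = \<bar>g t\<bar> * ?x\<^sup>2 * exp (- u * cosh t + \<bar>?x\<bar>)"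
          unfolding exp_add by simp
        also have "\<dots> \<le> \<bar>g t\<bar> * ?x\<^sup>2 * exp (- (u / 2) * cosh t)"
        proof -
          have "2 * \<bar>d\<bar> * cosh t \<le> u * cosh t" using d by (intro mult_right_mono) auto
          then have "- u * cosh t + \<bar>?x\<bar> \<le> - (u / 2) * cosh t"
            unfolding abs_mult by (simp add: field_simps)
          then show ?thesis by (intro mult_left_mono) auto
        qed
        finally show ?thesis by (simp add: power2_eq_square algebra_simps)
      qed
    qed (rule i4)
    moreover have "(LINT t:{0<..}|lborel. d\<^sup>2 * (exp (- (u / 2) * cosh t) * (cosh t * cosh t * \<bar>g t\<bar>))) = d\<^sup>2 * B"
      unfolding B_def cosh_laplace_def set_integral_mult_right ..
    ultimately have "\<bar>(cosh_laplace g (u + d) - cosh_laplace g u) + d * cosh_laplace (\<lambda>t. cosh t * g t) u\<bar> \<le> d\<^sup>2 * B"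
      by linarith
    then have "\<bar>(cosh_laplace g (u + d) - cosh_laplace g u) + d * cosh_laplace (\<lambda>t. cosh t * g t) u\<bar> / \<bar>d\<bar> \<le> d\<^sup>2 * B / \<bar>d\<bar>"
      by (intro divide_right_mono) auto
    also have "d\<^sup>2 * B / \<bar>d\<bar> = \<bar>d\<bar> * B"
      using d by (simp add: field_simps power2_eq_square flip: abs_mult)
    finally show ?thesis
      using d by (simp add: add_divide_distrib flip: abs_divide)
  qed
  have "((\<lambda>d. (cosh_laplace g (u + d) - cosh_laplace g u) / d + cosh_laplace (\<lambda>t. cosh t * g t) u) \<longlongrightarrow> 0) (at 0)"
  proof (rule Lim_null_comparison)
    show "\<forall>\<^sub>F d in at 0. norm ((cosh_laplace g (u + d) - cosh_laplace g u) / d + cosh_laplace (\<lambda>t. cosh t * g t) u) \<le> \<bar>d\<bar> * B"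
      unfolding eventually_at using bound u by (intro exI[of _ "u / 2"]) (auto simp: dist_real_def)
    show "((\<lambda>d. \<bar>d\<bar> * B) \<longlongrightarrow> 0) (at 0)" by (auto intro!: tendsto_eq_intros)
  qed
  then show ?thesis
    unfolding DERIV_def by (intro LIM_zero_cancel[of _ "- _"]) simp
qed

section \<open>The Bessel function and its derivatives\<close>

text \<open>Minus the first derivative of \<open>besselK \<nu>\<close>, with the sign chosen to keep
  the integrand positive.\<close>

definition besselK1 :: "real \<Rightarrow> real \<Rightarrow> real" where
  "besselK1 \<nu> = cosh_laplace (\<lambda>t. cosh t * cosh (\<nu> * t))"

text \<open>The second derivative of \<open>besselK \<nu>\<close>; the nested product is the form
  that \<open>cosh_laplace_deriv\<close> produces.\<close>

definition besselK2 :: "real \<Rightarrow> real \<Rightarrow> real" where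
  "besselK2 \<nu> = cosh_laplace (\<lambda>t. cosh t * (cosh t * cosh (\<nu> * t)))"

lemma besselK_eq_cosh_laplace: "besselK \<nu> = cosh_laplace (\<lambda>t. cosh (\<nu> * t))"
  by (simp add: fun_eq_iff besselK_def cosh_laplace_def)

lemma besselK_pos: "u > 0 \<Longrightarrow> besselK \<nu> u > 0"
  unfolding besselK_eq_cosh_laplace by (rule cosh_laplace_pos) auto

lemma besselK1_pos: "u > 0 \<Longrightarrow> besselK1 \<nu> u > 0"
  unfolding besselK1_def by (rule cosh_laplace_pos) auto

lemma besselK_deriv: "u > 0 \<Longrightarrow> (besselK \<nu> has_real_derivative - besselK1 \<nu> u) (at u)"
  unfolding besselK_eq_cosh_laplace besselK1_def by (rule cosh_laplace_deriv) auto

lemma besselK1_deriv: "u > 0 \<Longrightarrow> (besselK1 \<nu> has_real_derivative - besselK2 \<nu> u) (at u)"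
  unfolding besselK1_def besselK2_def by (rule cosh_laplace_deriv) auto

text \<open>The modified Bessel equation \<open>u^2 K'' + u K' = (u^2 + \<nu>^2) K\<close>, obtained
  by integrating an exact derivative in \<open>t\<close>.\<close>

lemma besselK_ode:
  assumes "u > 0"
  shows "u\<^sup>2 * besselK2 \<nu> u = u * besselK1 \<nu> u + (u\<^sup>2 + \<nu>\<^sup>2) * besselK \<nu> u"
proof -
  let ?c = "\<lambda>t. cosh (\<nu> * t)"
  let ?k = "\<lambda>t. (u * (cosh t * ?c t) + (u\<^sup>2 + \<nu>\<^sup>2) * ?c t) + (- (u\<^sup>2)) * (cosh t * (cosh t * ?c t))"
  have "cosh_laplace ?k u = 0"
  proof (rule cosh_laplace_FTC)
    \<comment> \<open>On differentiation, the mixed terms in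
      \<open>sinh t * sinh (\<nu> * t)\<close> coming from the two summands cancel.\<close>
    show "exp_growth (\<lambda>t. u * (sinh t * ?c t) + \<nu> * sinh (\<nu> * t))"
      by (intro exp_growth_add exp_growth_mult) auto
    show "exp_growth ?k" by (intro exp_growth_add exp_growth_mult) auto
    fix t :: real
    have "(cosh t)\<^sup>2 = (sinh t)\<^sup>2 + 1" by (rule cosh_square_eq)
    then have *: "u\<^sup>2 * (cosh t * (cosh t * ?c t)) = u\<^sup>2 * (sinh t * (sinh t * ?c t)) + u\<^sup>2 * ?c t"
      unfolding power2_eq_square by algebra
    show "((\<lambda>t. exp (- u * cosh t) * (u * (sinh t * ?c t) + \<nu> * sinh (\<nu> * t)))
        has_real_derivative exp (- u * cosh t) * ?k t) (at t)"
      unfolding mult_minus_left[of "u\<^sup>2"] *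
      by (auto intro!: derivative_eq_intros simp: algebra_simps power2_eq_square)
  qed (use assms in auto)
  moreover have "cosh_laplace ?k u =
      u * besselK1 \<nu> u + (u\<^sup>2 + \<nu>\<^sup>2) * besselK \<nu> u + (- (u\<^sup>2)) * besselK2 \<nu> u"
    unfolding besselK_eq_cosh_laplace besselK1_def besselK2_def
    by (rule cosh_laplace_lincomb) (use assms in \<open>auto simp: exp_growth_mult\<close>)
  ultimately show ?thesis by simp
qed

text \<open>Cauchy-Schwarz in variance form: \<open>m\<close> is the mean of \<open>cosh t\<close>
  under the weight \<open>exp (- u * cosh t) * cosh (\<nu> * t)\<close>, and the integral of
  \<open>(cosh t - m)^2\<close> against that weight is positive.\<close>

lemma besselK_log_convex:
  assumes "u > 0"
  shows "(besselK1 \<nu> u)\<^sup>2 < besselK \<nu> u * besselK2 \<nu> u"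
proof -
  let ?c = "\<lambda>t. cosh (\<nu> * t)"
  define m where "m = besselK1 \<nu> u / besselK \<nu> u"
  let ?k = "\<lambda>t. (1 * (cosh t * (cosh t * ?c t)) + (- 2 * m) * (cosh t * ?c t)) + m\<^sup>2 * ?c t"
  have K: "besselK \<nu> u > 0" using besselK_pos[OF assms] .
  have k: "?k t = ?c t * (cosh t - m)\<^sup>2" for t by (simp add: power2_eq_square algebra_simps)
  have "0 < cosh_laplace ?k u"
  proof (rule cosh_laplace_pos)
    show "exp_growth ?k" by (intro exp_growth_add exp_growth_mult) auto
    show "?k t \<ge> 0" for t unfolding k by simp
    \<comment> \<open>\<open>cosh\<close> is injective on the positive axis, so the square has at
      most one zero there.\<close>
    have "{t. t > 0 \<and> ?k t = 0} \<subseteq> {arcosh m}"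
      unfolding k by (auto simp: arcosh_cosh_real)
    then show "finite {t. t > 0 \<and> ?k t = 0}" by (rule finite_subset) simp
  qed (rule assms)
  also have "cosh_laplace ?k u = 1 * besselK2 \<nu> u + (- 2 * m) * besselK1 \<nu> u + m\<^sup>2 * besselK \<nu> u"
    unfolding besselK_eq_cosh_laplace besselK1_def besselK2_def
    by (rule cosh_laplace_lincomb) (use assms in \<open>auto simp: exp_growth_mult\<close>)
  finally have "0 < besselK \<nu> u * (1 * besselK2 \<nu> u + (- 2 * m) * besselK1 \<nu> u + m\<^sup>2 * besselK \<nu> u)"
    using K by (simp del: mult_minus_left)
  also have "\<dots> = besselK \<nu> u * besselK2 \<nu> u - (besselK1 \<nu> u)\<^sup>2"
    using K by (simp add: m_def field_simps power2_eq_square)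
  finally show ?thesis by simp
qed

text \<open>The pointwise form of Turan's inequality: the two sides differ by exactly
  \<open>(sinh t)^2\<close>.\<close>

lemma cosh_shift_prod_gt:
  fixes t \<nu> :: real
  assumes "t \<noteq> 0"
  shows "(cosh (\<nu> * t))\<^sup>2 < cosh ((\<nu> - 1) * t) * cosh ((\<nu> + 1) * t)"
proof -
  have 1: "(cosh (\<nu> * t))\<^sup>2 = (sinh (\<nu> * t))\<^sup>2 + 1" "(cosh t)\<^sup>2 = (sinh t)\<^sup>2 + 1"
    by (rule cosh_square_eq)+
  have "cosh ((\<nu> - 1) * t) * cosh ((\<nu> + 1) * t) = (cosh (\<nu> * t) * cosh t)\<^sup>2 - (sinh (\<nu> * t) * sinh t)\<^sup>2"
    by (simp add: left_diff_distrib distrib_right cosh_add cosh_diff power2_eq_square algebra_simps)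
  also have "\<dots> = (cosh (\<nu> * t))\<^sup>2 + (sinh t)\<^sup>2"
    using 1 unfolding power_mult_distrib by algebra
  finally show ?thesis using assms by simp
qed

text \<open>Turan's inequality \<open>K\<^bsub>\<nu>-1\<^esub>(u) K\<^bsub>\<nu>+1\<^esub>(u) > K\<^sub>\<nu>(u)\<^sup>2\<close>, rewritten through
  \<open>K\<^bsub>\<nu>\<plusminus>1\<^esub> = - K\<^sub>\<nu>' \<plusminus> (\<nu>/u) K\<^sub>\<nu>\<close>.\<close>
lemma besselK_turan:
  assumes "u > 0"
  shows "(u\<^sup>2 + \<nu>\<^sup>2) * (besselK \<nu> u)\<^sup>2 < u\<^sup>2 * (besselK1 \<nu> u)\<^sup>2"
proof -
  \<comment> \<open>Half of \<open>K_(\<nu>+1) - K_(\<nu>-1)\<close>. Integrating the derivative of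
    \<open>exp (- u * cosh t) * sinh (\<nu> * t)\<close> identifies it as
    \<open>(\<nu> / u) K_\<nu>\<close>.\<close>
  define S where "S = cosh_laplace (\<lambda>t. sinh t * sinh (\<nu> * t)) u"
  let ?k = "\<lambda>t. \<nu> * cosh (\<nu> * t) + (- u) * (sinh t * sinh (\<nu> * t))"
  have "cosh_laplace ?k u = 0"
  proof (rule cosh_laplace_FTC)
    show "exp_growth (\<lambda>t. sinh (\<nu> * t))" by auto
    show "exp_growth ?k" by (intro exp_growth_add exp_growth_mult) auto
    show "((\<lambda>t. exp (- u * cosh t) * sinh (\<nu> * t)) has_real_derivative exp (- u * cosh t) * ?k t) (at t)" for t
      by (auto intro!: derivative_eq_intros simp: algebra_simps)
  qed (use assms in auto)
  moreover have "cosh_laplace ?k u = \<nu> * besselK \<nu> u + (- u) * S"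
    unfolding besselK_eq_cosh_laplace S_def
    by (rule cosh_laplace_lincomb(1)[where h = cosh]) (use assms in \<open>auto simp: exp_growth_mult\<close>)
  ultimately have S: "\<nu> * besselK \<nu> u = u * S" by simp
  have K: "besselK \<nu> u > 0" using besselK_pos[OF assms] .
  have pos: "besselK \<mu> u > 0" for \<mu> using besselK_pos[OF assms] .
  \<comment> \<open>The addition theorem for \<open>cosh\<close>, for both neighbouring orders at
    once.\<close>
  have shift: "besselK (\<nu> + \<epsilon>) u = besselK1 \<nu> u + \<epsilon> * S" if "\<epsilon> \<in> {-1, 1}" for \<epsilon>
  proof -
    have "(\<lambda>t. cosh ((\<nu> + \<epsilon>) * t)) = (\<lambda>t. 1 * (cosh t * cosh (\<nu> * t)) + \<epsilon> * (sinh t * sinh (\<nu> * t)))"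
      using that by (auto simp: cosh_add cosh_diff algebra_simps)
    moreover have "cosh_laplace (\<lambda>t. 1 * (cosh t * cosh (\<nu> * t)) + \<epsilon> * (sinh t * sinh (\<nu> * t))) u
        = 1 * besselK1 \<nu> u + \<epsilon> * S"
      unfolding besselK1_def S_def
      by (rule cosh_laplace_lincomb(1)[where h = cosh]) (use assms in \<open>auto simp: exp_growth_mult\<close>)
    ultimately show ?thesis unfolding besselK_eq_cosh_laplace by simp
  qed
  have up: "besselK (\<nu> + 1) u = besselK1 \<nu> u + S" using shift[of 1] by simp
  have down: "besselK (\<nu> - 1) u = besselK1 \<nu> u - S" using shift[of "-1"] by simp
  \<comment> \<open>This value balances the outer terms,
    \<open>l^2 K_(\<nu>-1) = K_(\<nu>+1)\<close>, so that the integrated AM-GM inequality below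
    becomes the product inequality.\<close>
  define l where "l = sqrt (besselK (\<nu> + 1) u / besselK (\<nu> - 1) u)"
  have l: "l > 0" "l\<^sup>2 = besselK (\<nu> + 1) u / besselK (\<nu> - 1) u"
    using pos[of "\<nu> + 1"] pos[of "\<nu> - 1"] by (auto simp: l_def)
  \<comment> \<open>Positive by AM-GM for the two outer terms, followed by
    \<open>cosh_shift_prod_gt\<close>.\<close>
  let ?j = "\<lambda>t. (l\<^sup>2 * cosh ((\<nu> - 1) * t) + 1 * cosh ((\<nu> + 1) * t)) + (- 2 * l) * cosh (\<nu> * t)"
  have j: "?j t > 0" if "t > 0" for t
  proof -
    define a where "a = cosh ((\<nu> - 1) * t)"
    define b where "b = cosh ((\<nu> + 1) * t)"
    have ab: "a > 0" "b > 0" by (simp_all add: a_def b_def)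
    have "cosh (\<nu> * t) < sqrt a * sqrt b"
      using cosh_shift_prod_gt[of t \<nu>] that
      by (simp add: real_less_rsqrt a_def b_def flip: real_sqrt_mult)
    then have "2 * l * cosh (\<nu> * t) < 2 * l * (sqrt a * sqrt b)" using l by simp
    also have "\<dots> \<le> l\<^sup>2 * a + b"
      using zero_le_power2[of "l * sqrt a - sqrt b"] ab by (simp add: power2_eq_square algebra_simps)
    finally show ?thesis by (simp add: a_def b_def)
  qed
  have "0 < cosh_laplace ?j u"
  proof (rule cosh_laplace_pos)
    have "{t. t > 0 \<and> ?j t = 0} = {}" using j by force
    then show "finite {t. t > 0 \<and> ?j t = 0}" by (metis finite.emptyI)
    show "exp_growth ?j" by (intro exp_growth_add exp_growth_mult) auto
  qed (use assms j in \<open>auto intro: less_imp_le simp del: mult_minus_left\<close>)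
  also have "cosh_laplace ?j u = l\<^sup>2 * besselK (\<nu> - 1) u + 1 * besselK (\<nu> + 1) u + (- 2 * l) * besselK \<nu> u"
    unfolding besselK_eq_cosh_laplace
    by (rule cosh_laplace_lincomb) (use assms in \<open>auto simp: exp_growth_mult\<close>)
  also have "\<dots> = 2 * (l * (l * besselK (\<nu> - 1) u - besselK \<nu> u))"
    using l pos[of "\<nu> - 1"] by (simp add: field_simps power2_eq_square)
  finally have "besselK \<nu> u < l * besselK (\<nu> - 1) u" using l by (simp add: zero_less_mult_iff)
  then have "(besselK \<nu> u)\<^sup>2 < (l * besselK (\<nu> - 1) u)\<^sup>2" using K by (intro power_strict_mono) auto
  also have "\<dots> = besselK (\<nu> + 1) u * besselK (\<nu> - 1) u"
    using l pos[of "\<nu> - 1"] by (simp add: power_mult_distrib) (simp add: power2_eq_square)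
  also have "\<dots> = (besselK1 \<nu> u)\<^sup>2 - S\<^sup>2" unfolding up down by (simp add: power2_eq_square algebra_simps)
  finally have "u\<^sup>2 * (besselK \<nu> u)\<^sup>2 < u\<^sup>2 * ((besselK1 \<nu> u)\<^sup>2 - S\<^sup>2)" using assms by simp
  also have "\<dots> = u\<^sup>2 * (besselK1 \<nu> u)\<^sup>2 - (\<nu> * besselK \<nu> u)\<^sup>2" unfolding S by (simp add: power2_eq_square algebra_simps)
  finally show ?thesis by (simp add: power2_eq_square algebra_simps)
qed

section \<open>Bounds for the logarithmic slope\<close>

text \<open>Minus the derivative of \<open>ln K_\<nu>\<close> with respect to
  \<open>ln u\<close>.\<close>

definition bessel_slope :: "real \<Rightarrow> real \<Rightarrow> real" where
  "bessel_slope \<nu> u = u * besselK1 \<nu> u / besselK \<nu> u"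

lemma bessel_slope_pos: "u > 0 \<Longrightarrow> bessel_slope \<nu> u > 0"
  by (simp add: bessel_slope_def besselK_pos besselK1_pos)

lemma bessel_slope_lower:
  assumes "u > 0"
  shows "u\<^sup>2 + \<nu>\<^sup>2 < (bessel_slope \<nu> u)\<^sup>2"
  using besselK_turan[OF assms, of \<nu>] besselK_pos[OF assms, of \<nu>]
  by (simp add: bessel_slope_def power_divide power_mult_distrib pos_less_divide_eq)

text \<open>Drop \<open>u^2\<close> from the Turan bound. This form compares the slope with
  \<open>\<nu>\<close> alone, uniformly in \<open>u\<close>.\<close>

lemma bessel_slope_gt_order:
  assumes "u > 0"
  shows "\<bar>\<nu>\<bar> < bessel_slope \<nu> u"
proof (rule power2_less_imp_less)
  show "\<bar>\<nu>\<bar>\<^sup>2 < (bessel_slope \<nu> u)\<^sup>2"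
    using bessel_slope_lower[OF assms, of \<nu>] zero_le_power2[of u] unfolding power2_abs by linarith
qed (use bessel_slope_pos[OF assms, of \<nu>] in simp)

text \<open>Log-convexity, with the second derivative eliminated by Bessel's equation.\<close>

lemma bessel_slope_log_convex:
  assumes "u > 0"
  shows "(bessel_slope \<nu> u)\<^sup>2 < u\<^sup>2 + \<nu>\<^sup>2 + bessel_slope \<nu> u"
proof -
  let ?K = "besselK \<nu> u" and ?L = "besselK1 \<nu> u"
  have K: "?K > 0" using besselK_pos[OF assms] .
  have "u\<^sup>2 * ?L\<^sup>2 < u\<^sup>2 * (?K * besselK2 \<nu> u)"
    using besselK_log_convex[OF assms] assms by simp
  also have "\<dots> = ?K * (u * ?L + (u\<^sup>2 + \<nu>\<^sup>2) * ?K)"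
    unfolding besselK_ode[OF assms, symmetric] by simp
  also have "\<dots> = (u\<^sup>2 + \<nu>\<^sup>2 + bessel_slope \<nu> u) * ?K\<^sup>2"
    using K by (simp add: bessel_slope_def field_simps power2_eq_square)
  finally show ?thesis
    using K by (simp add: bessel_slope_def power_divide power_mult_distrib pos_divide_less_eq)
qed

text \<open>With \<open>s = bessel_slope \<nu>\<close>, the difference of the two sides times \<open>K\<^sub>\<nu>\<^sup>2\<close> is increasing in \<open>u\<close>, so a
  violation at one point persists to the right. Then log-convexity forces \<open>u\<^sup>2 < (\<nu> - 1) * s u\<close>
  there, while \<open>s u / u = - K\<^sub>\<nu>' / K\<^sub>\<nu>\<close> is decreasing and hence bounded.\<close>
lemma bessel_slope_upper:
  assumes "u0 > 0" and nu: "\<nu> > 1"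
  shows "(\<nu> - 1) * (bessel_slope \<nu> u0)\<^sup>2 < (\<nu> - 1) * \<nu>\<^sup>2 + \<nu> * u0\<^sup>2"
proof (rule ccontr)
  assume neg: "\<not> ?thesis"
  let ?K = "besselK \<nu>" and ?L = "besselK1 \<nu>"
  let ?\<Phi> = "\<lambda>u. (\<nu> - 1) * u\<^sup>2 * (?L u)\<^sup>2 - ((\<nu> - 1) * \<nu>\<^sup>2 + \<nu> * u\<^sup>2) * (?K u)\<^sup>2"
  have \<Phi>: "?\<Phi> u = ((\<nu> - 1) * (bessel_slope \<nu> u)\<^sup>2 - ((\<nu> - 1) * \<nu>\<^sup>2 + \<nu> * u\<^sup>2)) * (?K u)\<^sup>2"
    if "u > 0" for u
    using besselK_pos[OF that, of \<nu>] by (simp add: bessel_slope_def field_simps)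
  have \<Phi>_mono: "?\<Phi> u0 \<le> ?\<Phi> u" if "u0 \<le> u" for u
  proof (rule DERIV_nonneg_imp_nondecreasing[OF that], intro exI conjI)
    fix x assume "u0 \<le> x" "x \<le> u"
    then have x: "x > 0" using \<open>u0 > 0\<close> by simp
    have ode: "x\<^sup>2 * besselK2 \<nu> x = x * ?L x + (x\<^sup>2 + \<nu>\<^sup>2) * ?K x" by (rule besselK_ode[OF x])
    have "(?\<Phi> has_real_derivative 2 * (\<nu> - 1) * x * (?L x)\<^sup>2 - 2 * (\<nu> - 1) * ?L x * (x\<^sup>2 * besselK2 \<nu> x)
        - 2 * \<nu> * x * (?K x)\<^sup>2 + 2 * ((\<nu> - 1) * \<nu>\<^sup>2 + \<nu> * x\<^sup>2) * ?K x * ?L x) (at x)"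
      by (auto intro!: derivative_eq_intros besselK_deriv besselK1_deriv x simp: algebra_simps power2_eq_square)
    \<comment> \<open>After inserting Bessel's equation the squares of \<open>?L x\<close> cancel,
      and the coefficient of \<open>2 * x^2 * ?K x * ?L x\<close> is
      \<open>\<nu> - (\<nu> - 1) = 1\<close>. The sign is thus that of slope minus
      \<open>\<nu>\<close>.\<close>
    also have "2 * (\<nu> - 1) * x * (?L x)\<^sup>2 - 2 * (\<nu> - 1) * ?L x * (x\<^sup>2 * besselK2 \<nu> x)
        - 2 * \<nu> * x * (?K x)\<^sup>2 + 2 * ((\<nu> - 1) * \<nu>\<^sup>2 + \<nu> * x\<^sup>2) * ?K x * ?L x
        = 2 * x * ?K x * (x * ?L x - \<nu> * ?K x)"
      unfolding ode by (simp add: algebra_simps power2_eq_square)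
    finally show "(?\<Phi> has_real_derivative 2 * x * ?K x * (x * ?L x - \<nu> * ?K x)) (at x)" .
    have "\<nu> * ?K x \<le> x * ?L x"
      using bessel_slope_gt_order[OF x, of \<nu>] besselK_pos[OF x, of \<nu>] nu
      by (simp add: bessel_slope_def pos_less_divide_eq)
    then show "0 \<le> 2 * x * ?K x * (x * ?L x - \<nu> * ?K x)"
      using x besselK_pos[OF x, of \<nu>] by simp
  qed
  have k_mono: "?L u / ?K u \<le> ?L u0 / ?K u0" if "u0 \<le> u" for u
  proof (rule DERIV_nonpos_imp_nonincreasing[OF that], intro exI conjI)
    fix x assume "u0 \<le> x" "x \<le> u"
    then have x: "x > 0" using \<open>u0 > 0\<close> by simp
    have K: "?K x > 0" using besselK_pos[OF x] .
    show "((\<lambda>u. ?L u / ?K u) has_real_derivative ((?L x)\<^sup>2 - ?K x * besselK2 \<nu> x) / (?K x)\<^sup>2) (at x)"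
      using K by (auto intro!: derivative_eq_intros besselK_deriv besselK1_deriv x simp: algebra_simps power2_eq_square)
    show "((?L x)\<^sup>2 - ?K x * besselK2 \<nu> x) / (?K x)\<^sup>2 \<le> 0"
      using besselK_log_convex[OF x, of \<nu>] by (intro divide_nonpos_nonneg) auto
  qed
  have "?\<Phi> u0 \<ge> 0" unfolding \<Phi>[OF \<open>u0 > 0\<close>] using neg by simp
  \<comment> \<open>Far enough right that the bounded quotient gives
    \<open>(\<nu> - 1) * bessel_slope \<nu> u <= u^2\<close>, and not left of \<open>u0\<close>,
    where the violation starts.\<close>
  define u where "u = max u0 ((\<nu> - 1) * (?L u0 / ?K u0))"
  have u: "u \<ge> u0" "u > 0" "u \<ge> (\<nu> - 1) * (?L u0 / ?K u0)" using \<open>u0 > 0\<close> by (auto simp: u_def)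
  have "?\<Phi> u \<ge> 0" using \<Phi>_mono[OF u(1)] \<open>?\<Phi> u0 \<ge> 0\<close> by linarith
  then have "(\<nu> - 1) * (bessel_slope \<nu> u)\<^sup>2 \<ge> (\<nu> - 1) * \<nu>\<^sup>2 + \<nu> * u\<^sup>2"
    unfolding \<Phi>[OF u(2)] using besselK_pos[OF u(2), of \<nu>] by (simp add: zero_le_mult_iff)
  moreover have "(\<nu> - 1) * (bessel_slope \<nu> u)\<^sup>2 < (\<nu> - 1) * (u\<^sup>2 + \<nu>\<^sup>2 + bessel_slope \<nu> u)"
    using bessel_slope_log_convex[OF u(2), of \<nu>] nu by simp
  ultimately have "u\<^sup>2 < (\<nu> - 1) * bessel_slope \<nu> u" by (simp add: algebra_simps)
  also have "\<dots> = (\<nu> - 1) * (?L u / ?K u) * u" by (simp add: bessel_slope_def)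
  also have "\<dots> \<le> (\<nu> - 1) * (?L u0 / ?K u0) * u"
    using k_mono[OF u(1)] nu u(2) by (intro mult_right_mono mult_left_mono) auto
  also have "\<dots> \<le> u * u" using u by (intro mult_right_mono) auto
  finally show False by (simp add: power2_eq_square)
qed

section \<open>Power means and a derivative criterion\<close>

text \<open>The generator of the power mean. Division by \<open>r\<close> makes it increasing for
  either sign of \<open>r\<close>, with derivative \<open>x powr (r - 1)\<close> also at
  \<open>r = 0\<close>.\<close>

definition power_scale :: "real \<Rightarrow> real \<Rightarrow> real" where
  "power_scale r x = (if r = 0 then ln x else x powr r / r)"

lemma power_scale_deriv:
  "x > 0 \<Longrightarrow> (power_scale r has_real_derivative x powr (r - 1)) (at x)"
  unfolding power_scale_def[abs_def]
  by (cases "r = 0") (auto intro!: derivative_eq_intros simp: powr_minus_divide powr_diff)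

lemma power_scale_less:
  assumes "0 < x" "x < y"
  shows "power_scale r x < power_scale r y"
proof (rule DERIV_pos_imp_increasing[OF assms(2)])
  fix z assume "x \<le> z" "z \<le> y"
  then show "\<exists>D. (power_scale r has_real_derivative D) (at z) \<and> D > 0"
    using assms by (intro exI[of _ "z powr (r - 1)"]) (auto intro: power_scale_deriv)
qed

lemma power_scale_less_iff:
  "0 < x \<Longrightarrow> 0 < y \<Longrightarrow> power_scale r x < power_scale r y \<longleftrightarrow> x < y"
  using power_scale_less[of x y r] power_scale_less[of y x r]
  by (cases x y rule: linorder_cases) auto

lemma power_scale_le_iff:
  "0 < x \<Longrightarrow> 0 < y \<Longrightarrow> power_scale r x \<le> power_scale r y \<longleftrightarrow> x \<le> y"
  using power_scale_less_iff[of y x r] by (simp add: not_less[symmetric])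

lemma convex_combination_pos:
  fixes a b w :: real
  assumes "a > 0" "b > 0" "w \<in> {0..1}"
  shows "w * a + (1 - w) * b > 0"
  using assms by (cases "w = 0") (auto intro!: add_pos_nonneg)

lemma power_mean_pos:
  assumes "x > 0" "y > 0" "w \<in> {0..1}"
  shows "power_mean r w x y > 0"
  using convex_combination_pos[of "x powr r" "y powr r" w] assms by (auto simp: power_mean_def)

lemma power_scale_power_mean:
  assumes "x > 0" "y > 0" "w \<in> {0..1}"
  shows "power_scale r (power_mean r w x y) = w * power_scale r x + (1 - w) * power_scale r y"
  using convex_combination_pos[of "x powr r" "y powr r" w] assms
  by (auto simp: power_mean_def power_scale_def powr_powr ln_mult ln_powr add_divide_distrib)

text \<open>\<open>F\<close> is the derivative of \<open>D\<close> with respect to the coordinate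
  \<open>power_scale p\<close>, so its growth makes \<open>D\<close> strictly convex there. The
  claim is Jensen's inequality for two points.\<close>

lemma increasing_ratio_power_mean:
  fixes D F :: "real \<Rightarrow> real"
  assumes deriv: "\<And>u. u > 0 \<Longrightarrow> (D has_real_derivative F u * u powr (p - 1)) (at u)"
    and mono: "\<And>u v. 0 < u \<Longrightarrow> u < v \<Longrightarrow> F u < F v"
    and pos: "u1 > 0" "u2 > 0" "w \<in> {0..1}"
  shows "D (power_mean p w u1 u2) \<le> w * D u1 + (1 - w) * D u2"
    and "w \<in> {0<..<1} \<Longrightarrow> u1 \<noteq> u2 \<Longrightarrow> D (power_mean p w u1 u2) < w * D u1 + (1 - w) * D u2"
proof -
  define m where "m = power_mean p w u1 u2"
  have m: "m > 0" unfolding m_def by (rule power_mean_pos[OF pos])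
  have sm: "power_scale p m = w * power_scale p u1 + (1 - w) * power_scale p u2"
    unfolding m_def by (rule power_scale_power_mean[OF pos])
  \<comment> \<open>\<open>D\<close> minus its tangent slope at \<open>m\<close> times the
    coordinate; its strict minimum is at \<open>m\<close>.\<close>
  define \<Phi> where "\<Phi> u = D u - F m * power_scale p u" for u
  have d: "(\<Phi> has_real_derivative (F u - F m) * u powr (p - 1)) (at u)" if "u > 0" for u
    unfolding \<Phi>_def
    by (auto intro!: derivative_eq_intros deriv power_scale_deriv that simp: algebra_simps)
  have \<Phi>: "\<Phi> m < \<Phi> u" if u: "u > 0" "u \<noteq> m" for u
  proof (cases "m < u")
    case True
    then obtain z where "z > m" "z < u" "\<Phi> u - \<Phi> m = (u - m) * ((F z - F m) * z powr (p - 1))"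
      using MVT2[OF True, of \<Phi> "\<lambda>u. (F u - F m) * u powr (p - 1)"] d m by force
    then show ?thesis using mono[OF m, of z] m True by (smt (verit) mult_pos_pos powr_gt_zero)
  next
    case False
    then have lt: "u < m" using u by simp
    then obtain z where "z > u" "z < m" "\<Phi> m - \<Phi> u = (m - u) * ((F z - F m) * z powr (p - 1))"
      using MVT2[OF lt, of \<Phi> "\<lambda>u. (F u - F m) * u powr (p - 1)"] d u by force
    then show ?thesis using mono[of z m] u lt
      by (smt (verit) mult_pos_neg mult_neg_pos powr_gt_zero)
  qed
  \<comment> \<open>The linear parts cancel, since \<open>m\<close> is the arithmetic mean in the
    coordinate \<open>power_scale p\<close>.\<close>
  have eq: "w * D u1 + (1 - w) * D u2 - D m = w * (\<Phi> u1 - \<Phi> m) + (1 - w) * (\<Phi> u2 - \<Phi> m)"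
    unfolding \<Phi>_def sm by (simp add: algebra_simps)
  have nn: "\<Phi> u - \<Phi> m \<ge> 0" if "u > 0" for u using \<Phi>[OF that] by (cases "u = m") auto
  show "D (power_mean p w u1 u2) \<le> w * D u1 + (1 - w) * D u2"
    using eq nn pos unfolding m_def[symmetric] by (smt (verit) atLeastAtMost_iff mult_nonneg_nonneg)
  assume w: "w \<in> {0<..<1}" and "u1 \<noteq> u2"
  then consider "u1 \<noteq> m" | "u2 \<noteq> m" by blast
  then have "w * (\<Phi> u1 - \<Phi> m) + (1 - w) * (\<Phi> u2 - \<Phi> m) > 0"
  proof cases
    case 1
    then show ?thesis using \<Phi>[of u1] nn[of u2] pos w by (intro add_pos_nonneg) auto
  next
    case 2
    then show ?thesis using \<Phi>[of u2] nn[of u1] pos w by (intro add_nonneg_pos) auto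
  qed
  then show "D (power_mean p w u1 u2) < w * D u1 + (1 - w) * D u2"
    using eq unfolding m_def by linarith
qed

text \<open>The chain rule, with \<open>u powr (1 - p) * u powr (p - 1) = 1\<close> inserted to fit
  \<open>increasing_ratio_power_mean\<close>.\<close>

lemma power_scale_compose_deriv:
  assumes "u > 0" "f u > 0" "(f has_real_derivative f' u) (at u)"
  shows "((\<lambda>u. power_scale q (f u)) has_real_derivative
    u powr (1 - p) * f u powr (q - 1) * f' u * u powr (p - 1)) (at u)"
proof -
  have "u powr (1 - p) * u powr (p - 1) = 1" using assms by (simp flip: powr_add)
  then have "u powr (1 - p) * f u powr (q - 1) * f' u * u powr (p - 1) = f u powr (q - 1) * f' u"
    by (metis (no_types) mult.assoc mult.commute mult.right_neutral)
  then show ?thesis using DERIV_chain2[OF power_scale_deriv[OF assms(2)] assms(3)] by metis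
qed

text \<open>In the coordinates \<open>power_scale p\<close> and \<open>power_scale q\<close> the two power means become arithmetic
  means, and the slope of \<open>f\<close> becomes \<open>u powr (1 - p) * f u powr (q - 1) * f' u\<close>.\<close>
lemma strictly_pq_convexI:
  fixes f f' :: "real \<Rightarrow> real"
  assumes pos: "\<And>u. u > 0 \<Longrightarrow> f u > 0"
    and deriv: "\<And>u. u > 0 \<Longrightarrow> (f has_real_derivative f' u) (at u)"
    and mono: "\<And>u v. 0 < u \<Longrightarrow> u < v \<Longrightarrow>
      u powr (1 - p) * f u powr (q - 1) * f' u < v powr (1 - p) * f v powr (q - 1) * f' v"
  shows "strictly_pq_convex p q f"
proof -
  let ?D = "\<lambda>u. power_scale q (f u)"
  have D: "(?D has_real_derivative u powr (1 - p) * f u powr (q - 1) * f' u * u powr (p - 1)) (at u)"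
    if "u > 0" for u by (rule power_scale_compose_deriv) (use that pos deriv in auto)
  note * = increasing_ratio_power_mean[OF D mono]
  have 1: "f (power_mean p w u1 u2) \<le> power_mean q w (f u1) (f u2)"
    if "u1 > 0" "u2 > 0" "w \<in> {0..1}" for u1 u2 w
    using *(1)[OF _ _ _ that] that
    by (simp add: pos power_mean_pos power_scale_power_mean flip: power_scale_le_iff[of _ _ q])
  have 2: "f (power_mean p w u1 u2) < power_mean q w (f u1) (f u2)"
    if "u1 > 0" "u2 > 0" "w \<in> {0<..<1}" "u1 \<noteq> u2" for u1 u2 w
  proof -
    have w: "w \<in> {0..1}" using that by simp
    show ?thesis using *(2)[OF _ _ _ that(1,2) w that(3,4)] that(1,2) w
      by (simp add: pos power_mean_pos power_scale_power_mean flip: power_scale_less_iff[of _ _ q])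
  qed
  show ?thesis unfolding strictly_pq_convex_def using 1 2 by blast
qed

text \<open>The convex argument applied to the negative of
  \<open>power_scale q (f u)\<close>.\<close>

lemma strictly_pq_concaveI:
  fixes f f' :: "real \<Rightarrow> real"
  assumes pos: "\<And>u. u > 0 \<Longrightarrow> f u > 0"
    and deriv: "\<And>u. u > 0 \<Longrightarrow> (f has_real_derivative f' u) (at u)"
    and mono: "\<And>u v. 0 < u \<Longrightarrow> u < v \<Longrightarrow>
      u powr (1 - p) * f u powr (q - 1) * f' u > v powr (1 - p) * f v powr (q - 1) * f' v"
  shows "strictly_pq_concave p q f"
proof -
  let ?D = "\<lambda>u. - power_scale q (f u)" and ?F = "\<lambda>u. - (u powr (1 - p) * f u powr (q - 1) * f' u)"
  have D: "(?D has_real_derivative ?F u * u powr (p - 1)) (at u)"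
    if "u > 0" for u
    using DERIV_minus[OF power_scale_compose_deriv[of u f f' q p]] that pos deriv by simp
  have F: "?F u < ?F v" if "0 < u" "u < v" for u v using mono[OF that] by simp
  note * = increasing_ratio_power_mean[OF D F]
  have 1: "f (power_mean p w u1 u2) \<ge> power_mean q w (f u1) (f u2)"
    if "u1 > 0" "u2 > 0" "w \<in> {0..1}" for u1 u2 w
    using *(1)[OF _ _ _ that] that
    by (simp add: pos power_mean_pos power_scale_power_mean flip: power_scale_le_iff[of _ _ q])
  have 2: "f (power_mean p w u1 u2) > power_mean q w (f u1) (f u2)"
    if "u1 > 0" "u2 > 0" "w \<in> {0<..<1}" "u1 \<noteq> u2" for u1 u2 w
  proof -
    have w: "w \<in> {0..1}" using that by simp
    show ?thesis using *(2)[OF _ _ _ that(1,2) w that(3,4)] that(1,2) w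
      by (simp add: pos power_mean_pos power_scale_power_mean flip: power_scale_less_iff[of _ _ q])
  qed
  show ?thesis unfolding strictly_pq_concave_def using 1 2 by blast
qed

section \<open>Convexity of the Bessel function\<close>

text \<open>Bessel's equation removes the second derivative. The factor split off is positive, so
  the sign is that of the bracket.\<close>

lemma besselK_weighted_slope_deriv:
  fixes p q \<nu> u :: real
  assumes "u > 0"
  defines "s \<equiv> bessel_slope \<nu> u"
  shows "((\<lambda>u. u powr (1 - p) * besselK \<nu> u powr (q - 1) * - besselK1 \<nu> u) has_real_derivative
    u powr (- p - 1) * besselK \<nu> u powr q * (p * s + (q - 1) * s\<^sup>2 + u\<^sup>2 + \<nu>\<^sup>2)) (at u)"
proof -
  let ?K = "besselK \<nu> u" and ?L = "besselK1 \<nu> u" and ?M = "besselK2 \<nu> u"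
  have K: "?K > 0" using besselK_pos[OF assms(1)] .
  have ode: "?M = (u * ?L + (u\<^sup>2 + \<nu>\<^sup>2) * ?K) / u\<^sup>2"
    using besselK_ode[OF assms(1), of \<nu>] assms(1) by (simp add: field_simps)
  have pw: "u powr (1 - p) = u powr (- p - 1) * u\<^sup>2" "u powr (- p) = u powr (- p - 1) * u"
    using assms(1) powr_add[of u "- p - 1" 2] powr_add[of u "- p - 1" 1] by (simp_all add: powr_numeral)
  have Kw: "?K powr (q - 1) = ?K powr q / ?K" "?K powr (q - 1 - 1) = ?K powr q / ?K\<^sup>2"
    using K powr_diff[of ?K q 1] powr_diff[of ?K q 2] by (simp_all add: powr_numeral)
  have "((\<lambda>u. u powr (1 - p) * besselK \<nu> u powr (q - 1) * - besselK1 \<nu> u) has_real_derivative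
      (1 - p) * u powr (- p) * ?K powr (q - 1) * - ?L
      + u powr (1 - p) * ((q - 1) * ?K powr (q - 1 - 1) * - ?L) * - ?L
      + u powr (1 - p) * ?K powr (q - 1) * ?M) (at u)"
  proof -
    have a: "((\<lambda>u. u powr (1 - p)) has_real_derivative (1 - p) * u powr (1 - p - 1)) (at u)"
      using has_real_derivative_powr[OF assms(1)] .
    have b: "((\<lambda>u. besselK \<nu> u powr (q - 1)) has_real_derivative (q - 1) * ?K powr (q - 1 - 1) * - ?L) (at u)"
      using DERIV_fun_powr[OF besselK_deriv[OF assms(1)] K, of "q - 1"] by simp
    have c: "((\<lambda>u. - besselK1 \<nu> u) has_real_derivative ?M) (at u)"
      using DERIV_minus[OF besselK1_deriv[OF assms(1)], of \<nu>] by simp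
    show ?thesis
      using DERIV_mult[OF DERIV_mult[OF a b] c] by (simp add: algebra_simps)
  qed
  also have "(1 - p) * u powr (- p) * ?K powr (q - 1) * - ?L
      + u powr (1 - p) * ((q - 1) * ?K powr (q - 1 - 1) * - ?L) * - ?L
      + u powr (1 - p) * ?K powr (q - 1) * ?M
    = u powr (- p - 1) * ?K powr q * (p * s + (q - 1) * s\<^sup>2 + u\<^sup>2 + \<nu>\<^sup>2)"
    unfolding pw Kw ode s_def bessel_slope_def
    using K assms(1) by (simp add: field_simps power2_eq_square)
  finally show ?thesis .
qed

section \<open>Sign criteria for the Bessel function and the five cases\<close>

lemma besselK_strictly_pq_convex:
  assumes "\<And>u s. u > 0 \<Longrightarrow> s = bessel_slope \<nu> u \<Longrightarrow> p * s + (q - 1) * s\<^sup>2 + u\<^sup>2 + \<nu>\<^sup>2 > 0"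
  shows "strictly_pq_convex p q (besselK \<nu>)"
proof (rule strictly_pq_convexI[where f' = "\<lambda>u. - besselK1 \<nu> u"])
  fix u v :: real assume "0 < u" "u < v"
  show "u powr (1 - p) * besselK \<nu> u powr (q - 1) * - besselK1 \<nu> u
      < v powr (1 - p) * besselK \<nu> v powr (q - 1) * - besselK1 \<nu> v"
  proof (rule DERIV_pos_imp_increasing[OF \<open>u < v\<close>])
    fix x assume "u \<le> x"
    then have x: "x > 0" using \<open>0 < u\<close> by simp
    show "\<exists>y. ((\<lambda>u. u powr (1 - p) * besselK \<nu> u powr (q - 1) * - besselK1 \<nu> u) has_real_derivative y) (at x) \<and> 0 < y"
      using besselK_weighted_slope_deriv[OF x] assms[OF x refl] x besselK_pos[OF x, of \<nu>]
      by (intro exI conjI) (assumption, auto)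
  qed
qed (auto intro: besselK_pos besselK_deriv)

lemma besselK_strictly_pq_concave:
  assumes "\<And>u s. u > 0 \<Longrightarrow> s = bessel_slope \<nu> u \<Longrightarrow> p * s + (q - 1) * s\<^sup>2 + u\<^sup>2 + \<nu>\<^sup>2 < 0"
  shows "strictly_pq_concave p q (besselK \<nu>)"
proof (rule strictly_pq_concaveI[where f' = "\<lambda>u. - besselK1 \<nu> u"])
  fix u v :: real assume "0 < u" "u < v"
  show "u powr (1 - p) * besselK \<nu> u powr (q - 1) * - besselK1 \<nu> u
      > v powr (1 - p) * besselK \<nu> v powr (q - 1) * - besselK1 \<nu> v"
  proof (rule DERIV_neg_imp_decreasing[OF \<open>u < v\<close>])
    fix x assume "u \<le> x"
    then have x: "x > 0" using \<open>0 < u\<close> by simp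
    show "\<exists>y. ((\<lambda>u. u powr (1 - p) * besselK \<nu> u powr (q - 1) * - besselK1 \<nu> u) has_real_derivative y) (at x) \<and> y < 0"
      using besselK_weighted_slope_deriv[OF x] assms[OF x refl] x besselK_pos[OF x, of \<nu>]
      by (intro exI conjI) (assumption, auto intro!: mult_pos_neg)
  qed
qed (auto intro: besselK_pos besselK_deriv)

text \<open>Multiply by \<open>\<nu>\<close> and replace \<open>\<nu> * u^2\<close> by its lower
  bound from \<open>upper\<close>. What remains is the quadratic
  \<open>A * s^2 + \<nu> * p * s + \<nu>^2\<close> in \<open>s\<close>, to be shown nonnegative for
  \<open>s > \<nu>\<close>.\<close>

lemma convexity_quadratic_pos:
  fixes p q \<nu> s u :: real
  assumes p: "p \<le> 0" and q: "q \<ge> 1" and nu: "\<nu> > 1" and s: "s > \<nu>"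
    and upper: "(\<nu> - 1) * s\<^sup>2 < (\<nu> - 1) * \<nu>\<^sup>2 + \<nu> * u\<^sup>2"
    and cond: "p\<^sup>2 \<le> 4 * (\<nu> - 1) * ((q - 1) * \<nu> + 1)"
  shows "p * s + (q - 1) * s\<^sup>2 + u\<^sup>2 + \<nu>\<^sup>2 > 0"
proof -
  define A where "A = \<nu> * q - 1"
  have A1: "A \<ge> \<nu> - 1" using mult_left_mono[OF q, of \<nu>] nu by (simp add: A_def)
  have A: "A > 0" using A1 nu by simp
  have "A * s\<^sup>2 + \<nu> * p * s + \<nu>\<^sup>2 \<ge> 0"
  \<comment> \<open>Here the discriminant may be positive. But AM-GM turns \<open>cond\<close> into
    \<open>- p <= \<nu> * q = A + 1\<close>, and at \<open>p = - (A + 1)\<close> the quadratic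
    factors as \<open>(s - \<nu>) * (A * s - \<nu>)\<close>.\<close>
  proof (cases "\<nu> * q \<ge> 2")
    case True
    have "4 * (\<nu> - 1) * ((q - 1) * \<nu> + 1) \<le> (\<nu> * q)\<^sup>2"
      using zero_le_power2[of "(\<nu> - 1) - ((q - 1) * \<nu> + 1)"] by (simp add: power2_eq_square algebra_simps)
    then have "(- p)\<^sup>2 \<le> (\<nu> * q)\<^sup>2" using cond unfolding power2_minus by linarith
    then have "- p \<le> \<nu> * q" by (rule power2_le_imp_le) (use nu q in auto)
    then have "- (\<nu> * q) * (\<nu> * s) \<le> p * (\<nu> * s)" using nu s by (intro mult_right_mono) auto
    moreover have "1 * s \<le> A * s" using True s nu by (intro mult_right_mono) (auto simp: A_def)
    then have "(s - \<nu>) * (A * s - \<nu>) \<ge> 0" using s by (intro mult_nonneg_nonneg) auto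
    ultimately show ?thesis by (simp add: A_def power2_eq_square algebra_simps)
  next
    case False
    have "\<nu> \<le> \<nu> * q" using mult_left_mono[OF q, of \<nu>] nu by simp
    then have "\<nu> < 2" using False by simp
    \<comment> \<open>This product is \<open>A - (\<nu> - 1) * ((q - 1) * \<nu> + 1)\<close>, so
      \<open>cond\<close> gives \<open>p^2 <= 4 * A\<close>: the discriminant is not positive, and
      completing the square suffices.\<close>
    then have "(2 - \<nu>) * (A - \<nu> + 1) \<ge> 0" using A1 by simp
    then have "4 * (\<nu> - 1) * ((q - 1) * \<nu> + 1) \<le> 4 * A" by (simp add: A_def power2_eq_square algebra_simps)
    then have "p\<^sup>2 \<le> 4 * A" using cond by linarith
    then have "\<nu>\<^sup>2 * (4 * A - p\<^sup>2) \<ge> 0" by (intro mult_nonneg_nonneg) auto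
    then have "4 * A * (A * s\<^sup>2 + \<nu> * p * s + \<nu>\<^sup>2) \<ge> 0"
      using zero_le_power2[of "2 * A * s + \<nu> * p"] by (simp add: power2_eq_square algebra_simps)
    then show ?thesis using A by (simp add: zero_le_mult_iff)
  qed
  then have "0 < \<nu> * (p * s + (q - 1) * s\<^sup>2 + u\<^sup>2 + \<nu>\<^sup>2)"
    using upper by (simp add: A_def power2_eq_square algebra_simps)
  then show ?thesis using nu by (simp add: zero_less_mult_iff)
qed

theorem theorem4:
  fixes p q \<nu> :: real
  shows
   "(p \<le> 0 \<and> q \<ge> 1 \<and> \<nu> > 1 \<and>
       4 * (1 - q) * p^2 * \<nu>^2 + 4 * (q - 2) * p^2 * \<nu> + p^2 * (p^2 + 4) \<le> 0
       \<longrightarrow> strictly_pq_convex p q (besselK \<nu>)) \<and>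
    (p \<le> 0 \<and> q \<le> 0 \<longrightarrow> strictly_pq_concave p q (besselK \<nu>)) \<and>
    (p \<ge> 0 \<and> q < 0 \<and> \<bar>\<nu>\<bar> \<ge> - p / q \<longrightarrow> strictly_pq_concave p q (besselK \<nu>)) \<and>
    (p \<ge> 0 \<and> q \<ge> 1 \<longrightarrow> strictly_pq_convex p q (besselK \<nu>)) \<and>
    (p \<ge> 1 \<and> q \<ge> 0 \<longrightarrow> strictly_pq_convex p q (besselK \<nu>))"
proof (intro conjI impI; elim conjE)
  assume p: "p \<le> 0" and q: "q \<ge> 1" and nu: "\<nu> > 1"
    and cond: "4 * (1 - q) * p^2 * \<nu>^2 + 4 * (q - 2) * p^2 * \<nu> + p^2 * (p^2 + 4) \<le> 0"
  \<comment> \<open>The hypothesis factors; \<open>p^2\<close> is then cancelled, while for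
    \<open>p = 0\<close> the bound holds because its right side is nonnegative.\<close>
  have "p\<^sup>2 * (p\<^sup>2 - 4 * (\<nu> - 1) * ((q - 1) * \<nu> + 1)) \<le> 0"
    using cond by (simp add: power2_eq_square algebra_simps)
  moreover have "4 * (\<nu> - 1) * ((q - 1) * \<nu> + 1) \<ge> 0" using nu q by simp
  ultimately have "p\<^sup>2 \<le> 4 * (\<nu> - 1) * ((q - 1) * \<nu> + 1)"
    by (cases "p = 0") (auto simp: mult_le_0_iff)
  then show "strictly_pq_convex p q (besselK \<nu>)"
    using convexity_quadratic_pos[OF p q nu] bessel_slope_gt_order[of _ \<nu>] bessel_slope_upper nu
    by (intro besselK_strictly_pq_convex) auto
next
  assume p: "p \<le> 0" and q: "q \<le> 0"
  show "strictly_pq_concave p q (besselK \<nu>)"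
  proof (rule besselK_strictly_pq_concave)
    fix u s assume u: "(u::real) > 0" and s: "s = bessel_slope \<nu> u"
    \<comment> \<open>These terms only help; the remaining \<open>- s^2 + u^2 + \<nu>^2\<close> is
      negative by Turan's bound.\<close>
    have "p * s \<le> 0" "q * s\<^sup>2 \<le> 0"
      using p q bessel_slope_pos[OF u, of \<nu>] by (auto simp: s mult_nonpos_nonneg)
    then show "p * s + (q - 1) * s\<^sup>2 + u\<^sup>2 + \<nu>\<^sup>2 < 0"
      using bessel_slope_lower[OF u, of \<nu>] by (simp add: s algebra_simps)
  qed
next
  assume p: "p \<ge> 0" and q: "q < 0" and nu: "\<bar>\<nu>\<bar> \<ge> - p / q"
  show "strictly_pq_concave p q (besselK \<nu>)"
  proof (rule besselK_strictly_pq_concave)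
    fix u s assume u: "(u::real) > 0" and s: "s = bessel_slope \<nu> u"
    \<comment> \<open>The order condition makes \<open>p * s + q * s^2 = (p + q * s) * s\<close>
      nonpositive, and Turan's bound again handles the rest.\<close>
    have "- p / q \<le> s" using nu bessel_slope_gt_order[OF u, of \<nu>] by (simp add: s)
    then have "p + q * s \<le> 0" using q by (simp add: field_simps)
    then have "(p + q * s) * s \<le> 0"
      using bessel_slope_pos[OF u, of \<nu>] by (simp add: s mult_nonpos_nonneg)
    then show "p * s + (q - 1) * s\<^sup>2 + u\<^sup>2 + \<nu>\<^sup>2 < 0"
      using bessel_slope_lower[OF u, of \<nu>] by (simp add: s power2_eq_square algebra_simps)
  qed
next
  assume p: "p \<ge> 0" and q: "q \<ge> 1"
  show "strictly_pq_convex p q (besselK \<nu>)"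
  proof (rule besselK_strictly_pq_convex)
    fix u s assume u: "(u::real) > 0" and s: "s = bessel_slope \<nu> u"
    show "p * s + (q - 1) * s\<^sup>2 + u\<^sup>2 + \<nu>\<^sup>2 > 0"
      using p q u bessel_slope_pos[OF u, of \<nu>]
      by (intro add_pos_nonneg add_nonneg_pos add_nonneg_nonneg) (auto simp: s)
  qed
next
  assume p: "p \<ge> 1" and q: "q \<ge> 0"
  show "strictly_pq_convex p q (besselK \<nu>)"
  proof (rule besselK_strictly_pq_convex)
    fix u s assume u: "(u::real) > 0" and s: "s = bessel_slope \<nu> u"
    \<comment> \<open>This reduces the claim to the extreme case \<open>p = 1\<close>,
      \<open>q = 0\<close>, which is exactly the log-convexity bound.\<close>
    have "1 * s \<le> p * s" "0 \<le> q * s\<^sup>2"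
      using p q bessel_slope_pos[OF u, of \<nu>] by (auto simp: s intro!: mult_right_mono)
    then show "p * s + (q - 1) * s\<^sup>2 + u\<^sup>2 + \<nu>\<^sup>2 > 0"
      using bessel_slope_log_convex[OF u, of \<nu>] by (simp add: s algebra_simps)
  qed
qed

end
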